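(* Let $p>2$ be a prime, let $G$ be a $p$-group whose commutator subgroup has order $p$, and let $F$ be a field of characteristic $p$. Then $t(FG)=t(FG^-)$, where $t(L)$ denotes the Lie nilpotency index of $L$.
   Context: $FG$ is the group algebra, with the classical involution $*$: the $F$-linear extension of $g\mapsto g^{-1}$, $g\in G$. $FG^-=\{x\in FG : x^*=-x\}$ is the set of skew symmetric elements; it is a Lie subalgebra of $FG$ under the Lie commutator $[x,y]=xy-yx$. Lie commutators are left-normed: $[x_0,x_1,\dots,x_n]=[[x_0,x_1,\dots,x_{n-1}],x_n]$. For $L=FG$ or $L=FG^-$, the term $\gamma_n(L)$ of the lower Lie central series is the $F$-linear span of all $[x_0,x_1,\dots,x_n]$ with $x_i\in L$; in particular $\gamma_0(L)=L$. $L$ is Lie nilpotent with Lie nilpotency index $t(L)=n$ if $\gamma_{n-1}(L)\neq 0$ and $\gamma_n(L)=0$. *)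

theory Defs
  imports "HOL-Algebra.Multiplicative_Group" "HOL-Algebra.Generated_Groups" "HOL-Library.Poly_Mapping"
    "HOL-Computational_Algebra.Primes"
begin

text \<open>
  The group algebra is the type \<open>'g \<Rightarrow>\<^sub>0 'f\<close> of finitely supported functions with the
  convolution product of \<^theory>\<open>HOL-Library.Poly_Mapping\<close>. That product convolves with respect
  to \<open>+\<close>, so the group is a type of class \<^class>\<open>group_add\<close>, which is not assumed
  commutative. Only the notation is additive: \<open>g + h\<close> is the group product and \<open>- g\<close> the
  inverse. The structure \<open>type_group\<close> makes the group-theoretic notions of HOL-Algebra
  available for it.
\<close>

definition type_group :: "'g::group_add monoid" where
  "type_group = \<lparr>carrier = UNIV, monoid.mult = (+), one = 0\<rparr>"

lemma type_group_simps [simp]: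
  "carrier type_group = UNIV"
  "g \<otimes>\<^bsub>type_group\<^esub> h = g + h"
  "\<one>\<^bsub>type_group\<^esub> = 0"
  by (simp_all add: type_group_def)

lemma group_type_group: "group (type_group :: 'g::group_add monoid)"
proof (rule groupI)
  fix x :: 'g
  show "\<exists>y\<in>carrier type_group. y \<otimes>\<^bsub>type_group\<^esub> x = \<one>\<^bsub>type_group\<^esub>"
    by (rule bexI[of _ "- x"]) simp_all
qed (simp_all add: add.assoc)

lemma inv_type_group [simp]: "inv\<^bsub>type_group\<^esub> g = - (g :: 'g::group_add)"
  using group.inv_equality[OF group_type_group, of "- g" g] by simp

text \<open>A \<open>p\<close>-group may be infinite. Elements of infinite order have \<open>ord = 0\<close>.\<close>

definition p_group :: "nat \<Rightarrow> ('a, 'b) monoid_scheme \<Rightarrow> bool" where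
  "p_group p G \<longleftrightarrow> group G \<and> (\<forall>x\<in>carrier G. \<exists>k. group.ord G x = p ^ k)"

abbreviation ga_scale :: "'f::field \<Rightarrow> ('g \<Rightarrow>\<^sub>0 'f) \<Rightarrow> ('g \<Rightarrow>\<^sub>0 'f)" where
  "ga_scale c \<equiv> Poly_Mapping.map ((*) c)"

lemma lookup_ga_scale [simp]: "Poly_Mapping.lookup (ga_scale c x) g = c * Poly_Mapping.lookup x g"
  by (simp add: Poly_Mapping.map.rep_eq when_def)

lemma vector_space_ga_scale:
  "vector_space (ga_scale :: 'f::field \<Rightarrow> ('g \<Rightarrow>\<^sub>0 'f) \<Rightarrow> ('g \<Rightarrow>\<^sub>0 'f))"
  by unfold_locales (auto intro!: poly_mapping_eqI simp: lookup_add algebra_simps)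

definition ga_star :: "('g::group_add \<Rightarrow>\<^sub>0 'f::field) \<Rightarrow> ('g \<Rightarrow>\<^sub>0 'f)" where
  "ga_star x = (\<Sum>g\<in>Poly_Mapping.keys x. Poly_Mapping.single (- g) (Poly_Mapping.lookup x g))"

lemma lookup_ga_star: "Poly_Mapping.lookup (ga_star x) g = Poly_Mapping.lookup x (- g)"
proof -
  have "Poly_Mapping.lookup (ga_star x) g = (\<Sum>h\<in>Poly_Mapping.keys x. if h = - g then Poly_Mapping.lookup x h else 0)"
    unfolding ga_star_def lookup_sum
    by (rule sum.cong) (auto simp: lookup_single when_def)
  also have "\<dots> = Poly_Mapping.lookup x (- g)"
    by (simp add: in_keys_iff)
  finally show ?thesis .
qed

definition skew_elements :: "('g::group_add \<Rightarrow>\<^sub>0 'f::field) set" where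
  "skew_elements = {x. ga_star x = - x}"

fun left_normed :: "(nat \<Rightarrow> 'a::ring) \<Rightarrow> nat \<Rightarrow> 'a" where
  "left_normed x 0 = x 0"
| "left_normed x (Suc n) = left_normed x n * x (Suc n) - x (Suc n) * left_normed x n"

definition lower_central ::
  "('g::group_add \<Rightarrow>\<^sub>0 'f::field) set \<Rightarrow> nat \<Rightarrow> ('g \<Rightarrow>\<^sub>0 'f) set" where
  "lower_central L n = module.span ga_scale {left_normed x n | x. \<forall>i\<le>n. x i \<in> L}"

definition has_lie_nilpotency_index ::
  "('g::group_add \<Rightarrow>\<^sub>0 'f::field) set \<Rightarrow> nat \<Rightarrow> bool" where
  "has_lie_nilpotency_index L n \<longleftrightarrow>
     n \<ge> 1 \<and> lower_central L (n - 1) \<noteq> {0} \<and> lower_central L n = {0}"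

definition lie_nilpotent :: "('g::group_add \<Rightarrow>\<^sub>0 'f::field) set \<Rightarrow> bool" where
  "lie_nilpotent L \<longleftrightarrow> (\<exists>n. has_lie_nilpotency_index L n)"

text \<open>The index is only meaningful under \<^const>\<open>lie_nilpotent\<close>.\<close>

definition lie_nilpotency_index :: "('g::group_add \<Rightarrow>\<^sub>0 'f::field) set \<Rightarrow> nat" where
  "lie_nilpotency_index L = (THE n. has_lie_nilpotency_index L n)"

end

theory Submission
  imports Defs "HOL-Number_Theory.Residues"
begin

text \<open>
  Both Lie nilpotency indices are equal to \<open>p\<close>.

  The derived subgroup has prime order, so it is cyclic with a generator \<open>z\<close>. It is also central: an
  element of a \<open>p\<close>-group acts on it by conjugation as an automorphism whose order is a power of \<open>p\<close>,
  while the automorphism group of a group of order \<open>p\<close> has order \<open>p - 1\<close>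
  (\<open>normal_prime_order_central\<close>). Hence \<open>w = 1 - z\<close> is a central element of the group algebra, and
  \<open>w ^ p = 1 - z ^ p = 0\<close> in characteristic \<open>p\<close>.

  For the upper bound, two group elements commute up to a power of \<open>z\<close>, so that every Lie commutator
  is a multiple of \<open>w\<close> (\<open>commutator_in_augmentation_ideal\<close>). As \<open>w\<close> is central, a commutator
  \<open>[x\<^sub>0, \<dots>, x\<^sub>n]\<close> is a multiple of \<open>w ^ n\<close>, which vanishes for \<open>n = p\<close>.

  For the lower bound it suffices to find \<open>p\<close> skew elements whose iterated commutator is not
  zero, since they also lie in the full group algebra. Choose \<open>a\<close>, \<open>b\<close> with \<open>b a = z a b\<close>. The map
  \<open>[_, b - b\<inverse>]\<close> acts on \<open>a F\<langle>b, z\<rangle>\<close> as multiplication by \<open>w (b + z\<inverse> b\<inverse>)\<close>, and on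
  \<open>a\<inverse> F\<langle>b, z\<rangle>\<close> as multiplication by \<open>(1 - z\<inverse>) (b + z b\<inverse>)\<close>. The factor \<open>w ^ (p - 1)\<close> is annihilated
  by \<open>1 - z\<close>, so it absorbs all powers of \<open>z\<close>, and because \<open>p - 1\<close> is even the signs agree too. Thus
  \<open>[a - a\<inverse>, b - b\<inverse>, \<dots>, b - b\<inverse>] = w ^ (p - 1) (a - a\<inverse>) (b + b\<inverse>) ^ (p - 1)\<close>,
  where \<open>p - 1\<close> entries equal \<open>b - b\<inverse>\<close> (\<open>left_normed_skew_char_p\<close>). The last factor is a unit, because the
  Frobenius map gives \<open>(b + b\<inverse>) ^ (p ^ m) = b ^ (p ^ m) + b ^ (- p ^ m) = 2\<close> once \<open>p ^ m\<close> is a multiple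
  of the order of \<open>b\<close> (\<open>mult_inverse_sum_cancel\<close>). The remaining factor has coefficient \<open>1\<close> at \<open>a\<close>
  (\<open>lookup_power_mult_diff_inverse\<close>): the only other way to reach \<open>a\<close> would be \<open>a = z ^ k a\<inverse>\<close>, but
  then \<open>a\<^sup>2\<close>, and with it the element \<open>a\<close> of odd order, would lie in the central subgroup \<open>\<langle>z\<rangle>\<close>,
  whereas \<open>a\<close> and \<open>b\<close> do not commute.
\<close>

section \<open>Groups whose derived subgroup has prime order\<close>

text \<open>
  Lagrange's theorem inside \<open>N\<close>, where the ambient group may be infinite.
\<close>

lemma (in group) ord_dvd_card_subgroup:
  assumes "subgroup N G" "d \<in> N"
  shows "ord d dvd card N"
proof -
  interpret N: group "G\<lparr>carrier := N\<rparr>"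
    using assms(1) by (rule subgroup.subgroup_is_group) (rule group_axioms)
  have d: "d \<in> carrier G"
    using assms by (rule subgroup.mem_carrier)
  have "subgroup (generate G {d}) (G\<lparr>carrier := N\<rparr>)"
    using assms d by (intro subgroup_incl generate_is_subgroup generate_subgroup_incl) auto
  from N.lagrange[OF this] show ?thesis
    unfolding generate_pow_card[OF d] order_def by simp (metis dvd_triv_right)
qed

lemma (in group) generate_eq_subgroup_of_prime_card:
  assumes "subgroup N G" "Factorial_Ring.prime (card N)" "d \<in> N" "d \<noteq> \<one>"
  shows "ord d = card N" "N = {d [^] k | k::nat. True}"
proof -
  have d: "d \<in> carrier G"
    using assms(1,3) by (rule subgroup.mem_carrier)
  show ord: "ord d = card N"
    using ord_dvd_card_subgroup[OF assms(1,3)] assms(2,4) ord_eq_1[OF d]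
    by (auto simp: prime_nat_iff)
  have "finite N"
    using assms(2) by (metis card.infinite not_prime_0)
  moreover have "generate G {d} \<subseteq> N"
    using assms by (intro generate_subgroup_incl) auto
  ultimately have "generate G {d} = N"
    using generate_pow_card[OF d] ord by (simp add: card_subset_eq)
  moreover have "ord d \<noteq> 0"
    using ord assms(2) by auto
  ultimately show "N = {d [^] k | k::nat. True}"
    using generate_pow_nat[OF d] by simp
qed

lemma cong_power_prime_power:
  fixes p k :: nat
  assumes "Factorial_Ring.prime p"
  shows "[k ^ (p ^ m) = k] (mod p)"
proof (induction m)
  case (Suc m)
  have fermat: "[j ^ p = j] (mod p)" for j
  proof (cases "p dvd j")
    case True
    moreover from this have "p dvd j ^ p"
      using assms prime_dvd_power_nat_iff prime_gt_0_nat by blast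
    ultimately show ?thesis
      by (simp add: cong_def mod_eq_0_iff_dvd)
  next
    case False
    then have "[j * j ^ (p - 1) = j * 1] (mod p)"
      using assms fermat_theorem cong_scalar_left by blast
    then show ?thesis
      using assms by (simp add: prime_gt_0_nat flip: power_Suc)
  qed
  have "[k ^ (p ^ Suc m) = (k ^ (p ^ m)) ^ p] (mod p)"
    by (simp add: mult.commute flip: power_mult)
  also have "[(k ^ (p ^ m)) ^ p = k ^ p ^ m] (mod p)"
    by (rule fermat)
  also note Suc
  finally show ?case .
qed simp

text \<open>
  Conjugation by \<open>g\<close> sends \<open>d\<close> to \<open>d ^ k\<close> for some \<open>k\<close>. If \<open>g\<close> has order \<open>p ^ m\<close>, conjugating \<open>p ^ m\<close>
  times gives \<open>k ^ (p ^ m) = 1\<close> modulo \<open>p\<close>, and Fermat's little theorem turns this into \<open>k = 1\<close>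
  modulo \<open>p\<close>.
\<close>

lemma (in group) normal_prime_order_central:
  assumes "p_group p G" and p: "Factorial_Ring.prime p"
    and N: "N \<lhd> G" "card N = p" and d: "d \<in> N" and g: "g \<in> carrier G"
  shows "g \<otimes> d = d \<otimes> g"
proof (cases "d = \<one>")
  case True
  then show ?thesis using g by simp
next
  case False
  have sub: "subgroup N G"
    using N(1) by (rule normal_imp_subgroup)
  have dG: "d \<in> carrier G"
    using sub d by (rule subgroup.mem_carrier)
  have N_eq: "N = {d [^] k | k::nat. True}" and ord: "ord d = p"
    using generate_eq_subgroup_of_prime_card[OF sub _ d False] N(2) p by auto
  have "g \<otimes> d \<otimes> inv g \<in> N"
    using N(1) g d by (rule normal.inv_op_closed2)
  then obtain k :: nat where k: "g \<otimes> d \<otimes> inv g = d [^] k"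
    using N_eq by auto
  then have gd: "g \<otimes> d = d [^] k \<otimes> g"
    using inv_solve_right[of "d [^] k" "g \<otimes> d" g] dG g by auto
  have gdm: "g \<otimes> d [^] m = d [^] (k * m) \<otimes> g" for m :: nat
  proof (induction m)
    case (Suc m)
    have "g \<otimes> d [^] Suc m = (g \<otimes> d [^] m) \<otimes> d"
      using dG g by (simp add: m_assoc)
    also have "\<dots> = d [^] (k * m) \<otimes> (g \<otimes> d)"
      using Suc dG g by (simp add: m_assoc)
    also have "\<dots> = d [^] (k * m) \<otimes> d [^] k \<otimes> g"
      using gd dG g by (simp add: m_assoc)
    also have "\<dots> = d [^] (k * Suc m) \<otimes> g"
      using dG by (simp add: nat_pow_mult add.commute)
    finally show ?case .
  qed (use g in simp)
  have gn: "g [^] n \<otimes> d = d [^] (k ^ n) \<otimes> g [^] n" for n :: nat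
  proof (induction n)
    case (Suc n)
    have "g [^] Suc n \<otimes> d = g \<otimes> (g [^] n \<otimes> d)"
      using dG g by (simp only: nat_pow_Suc2 m_assoc nat_pow_closed)
    also have "\<dots> = (g \<otimes> d [^] (k ^ n)) \<otimes> g [^] n"
      using Suc dG g by (simp add: m_assoc)
    also have "\<dots> = d [^] (k ^ Suc n) \<otimes> (g \<otimes> g [^] n)"
      using gdm dG g by (simp add: m_assoc)
    also have "g \<otimes> g [^] n = g [^] Suc n"
      using g by (metis nat_pow_Suc2)
    finally show ?case .
  qed (use dG in simp)
  obtain m where m: "ord g = p ^ m"
    using assms(1) g unfolding p_group_def by blast
  have "d = d [^] (k ^ (p ^ m))"
    using gn[of "p ^ m"] pow_ord_eq_1[OF g] dG m by simp
  then have "d [^] int (k ^ (p ^ m)) = d [^] int 1"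
    using dG by (simp add: int_pow_int del: of_nat_power)
  then have "int p dvd int 1 - int (k ^ (p ^ m))"
    using int_pow_eq[OF dG] ord by blast
  then have "[k ^ (p ^ m) = 1] (mod p)"
    by (metis cong_iff_dvd_diff cong_int_iff cong_sym)
  with cong_power_prime_power[OF p] have "[k = 1] (mod p)"
    by (metis cong_sym cong_trans)
  then have "int (ord d) dvd int 1 - int k"
    using ord by (metis cong_iff_dvd_diff cong_int_iff cong_sym)
  then have "d [^] k = d"
    using int_pow_eq[OF dG, of "int k" "int 1"] dG by (simp add: int_pow_int)
  then show ?thesis
    using gd by simp
qed

text \<open>
  If \<open>a\<close> has order \<open>2 j + 1\<close>, then \<open>a\<close> is the inverse of the \<open>j\<close>-th power of its square.
\<close>

lemma odd_order_double_in_subgroup: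
  fixes a :: "'g::group_add"
  assumes N: "subgroup N type_group" and "a + a \<in> N" and "odd (group.ord type_group a)"
  shows "a \<in> N"
proof -
  interpret group "type_group :: 'g monoid" by (rule group_type_group)
  obtain j where j: "ord a = 2 * j + 1"
    using assms(3) by (auto elim: oddE)
  have "(a + a) [^]\<^bsub>type_group\<^esub> j + a = a [^]\<^bsub>type_group\<^esub> ord a"
    using nat_pow_pow[of a 2 j] by (simp add: j numeral_2_eq_2)
  also have "\<dots> = 0"
    using pow_ord_eq_1[of a] by simp
  finally have "a = - ((a + a) [^]\<^bsub>type_group\<^esub> j)"
    by (simp add: eq_neg_iff_add_eq_0 minus_unique)
  then have "a = inv\<^bsub>type_group\<^esub> ((a + a) [^]\<^bsub>type_group\<^esub> j)"
    by simp
  moreover have "(a + a) [^]\<^bsub>type_group\<^esub> j \<in> N"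
    using assms(2) by (induction j) (auto simp: subgroup.one_closed[OF N, simplified] subgroup.m_closed[OF N, simplified])
  ultimately show ?thesis
    using subgroup.m_inv_closed[OF N] by metis
qed

text \<open>
  Together with the orders of elements, this is all that the proof uses about the group. The last
  property keeps \<open>a\<close> and its inverse in different cosets of \<open>\<langle>z\<rangle>\<close>.
\<close>

lemma derived_order_p_noncommuting_pair:
  assumes p: "Factorial_Ring.prime p" "p > 2"
    and G: "p_group p (type_group :: 'g::group_add monoid)"
    and D: "card (derived (type_group :: 'g monoid) (carrier type_group)) = p"
  obtains a b z :: "'g::group_add" where
    "b + a = z + a + b" "group.ord type_group z = p"
    "\<And>g. z + g = g + z"
    "\<And>g h. \<exists>k::nat. g + h = z [^]\<^bsub>type_group\<^esub> k + (h + g)"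
    "\<And>k::nat. z [^]\<^bsub>type_group\<^esub> k + - a \<noteq> a"
proof -
  interpret group "type_group :: 'g monoid" by (rule group_type_group)
  define N where "N = derived (type_group :: 'g monoid) (carrier type_group)"
  have normal: "N \<lhd> type_group"
    unfolding N_def by (rule derived_is_normal[OF normal_self])
  then have sub: "subgroup N type_group"
    by (rule normal_imp_subgroup)
  have comm_in_N: "g + h - g - h \<in> N" for g h
  proof -
    have "g + h - g - h \<in> derived_set type_group (carrier type_group)"
      by auto
    then show ?thesis
      unfolding N_def derived_def by (rule generate.incl)
  qed
  have central: "g + d = d + g" if "d \<in> N" for d g
    using normal_prime_order_central[OF G p(1) normal _ that, of g] D by (simp add: N_def)
  have "\<exists>a b :: 'g. b + a \<noteq> a + b"
  proof (rule ccontr)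
    assume "\<nexists>a b :: 'g. b + a \<noteq> a + b"
    then have "g + h - g - h = 0" for g h :: 'g
      by (metis add_diff_cancel diff_self)
    then have "derived_set type_group (carrier type_group) \<subseteq> {0::'g}"
      by auto
    then have "N \<subseteq> {0}"
      unfolding N_def derived_def using triv_subgroup by (intro generate_subgroup_incl) auto
    then have "card N \<le> 1"
      using card_mono[of "{0}" N] by simp
    then show False
      using D p by (simp add: N_def prime_nat_iff)
  qed
  then obtain a b :: 'g where ab: "b + a \<noteq> a + b" by blast
  define z where "z = b + a - b - a"
  have zN: "z \<in> N"
    unfolding z_def by (rule comm_in_N)
  have ba: "b + a = z + a + b"
    by (simp add: z_def)
  have "z \<noteq> 0" using ab ba by auto
  then have ord: "ord z = p" and N_eq: "N = {z [^]\<^bsub>type_group\<^esub> k | k::nat. True}"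
    using generate_eq_subgroup_of_prime_card[OF sub _ zN] D p by (simp_all add: N_def)
  have "\<exists>k::nat. g + h = z [^]\<^bsub>type_group\<^esub> k + (h + g)" for g h
  proof -
    obtain k :: nat where "g + h - g - h = z [^]\<^bsub>type_group\<^esub> k"
      using comm_in_N[of g h] N_eq by auto
    then have "g + h = z [^]\<^bsub>type_group\<^esub> k + (h + g)"
      by (metis add.assoc diff_add_cancel)
    then show ?thesis ..
  qed
  moreover have "z [^]\<^bsub>type_group\<^esub> k + - a \<noteq> a" for k :: nat
  proof
    assume "z [^]\<^bsub>type_group\<^esub> k + - a = a"
    then have "a + a = z [^]\<^bsub>type_group\<^esub> k"
      by (metis add.assoc add.right_neutral left_minus)
    then have "a + a \<in> N"
      using N_eq by blast
    moreover have "odd (ord a)"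
      using G p prime_odd_nat[OF p(1)] unfolding p_group_def
      by (metis UNIV_I even_power nat_neq_iff type_group_simps(1))
    ultimately have "a \<in> N"
      by (rule odd_order_double_in_subgroup[OF sub])
    then show False
      using central[of a b] ab by simp
  qed
  ultimately show thesis
    using that[of b a z] ba ord central[OF zN] by metis
qed

text \<open>
  As the commutator \<open>z\<close> of \<open>b\<close> and \<open>a\<close> is central, inverting one of the two elements inverts it, and
  inverting both restores it.
\<close>

lemma commutation_of_inverses:
  fixes a b z :: "'g::group_add"
  assumes central: "\<And>g. z + g = g + z" and ba: "b + a = z + a + b"
  shows "- z + g = g + - z"
    and "- b + a = - z + a + - b"
    and "b + - a = - z + - a + b"
    and "- b + - a = z + - a + - b"
proof -
  have shift: "g + (z + h) = z + (g + h)" for g h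
    by (metis central add.assoc)
  have "z + (g + - z) = g"
    using shift[of g "- z"] by simp
  then show "- z + g = g + - z"
    by (metis minus_add_cancel)
  have "z + (- b + (a + b)) = a"
    by (metis shift ba add.assoc minus_add_cancel)
  then have "- b + (a + b) = - z + a"
    by (metis minus_add_cancel)
  then show "- b + a = - z + a + - b"
    by (metis add.assoc add.right_inverse add.right_neutral)
  have "- a + (b + a) = z + b"
    using shift[of "- a" "a + b"] ba by (simp add: add.assoc)
  then have "- z + (- a + (b + a)) = b"
    by simp
  then show "b + - a = - z + - a + b"
    by (metis add.assoc add.right_inverse add.right_neutral)
  have "- (b + a) = - (z + (a + b))"
    using ba by (simp add: add.assoc)
  also have "\<dots> = - (a + b) + - z"
    by (simp only: minus_add)
  finally show "- b + - a = z + - a + - b"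
    using shift[of "- (a + b)" "- z"] by (simp add: minus_add add.assoc del: add_uminus_conv_diff)
qed

section \<open>The Frobenius map on commuting elements\<close>

text \<open>
  The group algebra is not commutative, but each power to be expanded below is that of a sum of two
  commuting elements.
\<close>

lemma binomial_commuting:
  fixes x y :: "'a::semiring_1"
  assumes "x * y = y * x"
  shows "(x + y) ^ n = (\<Sum>k\<le>n. of_nat (n choose k) * (x ^ k * y ^ (n - k)))"
proof (induction n)
  case (Suc n)
  have x: "x * (of_nat c * u) = of_nat c * (x * u)" for c u
    by (metis mult.assoc mult_of_nat_commute)
  have y: "y * (of_nat c * (x ^ k * u)) = of_nat c * (x ^ k * (y * u))" for c k u
    using power_commuting_commutes[OF assms, of k] by (metis mult.assoc mult_of_nat_commute)
  have "(x + y) ^ Suc n = x * (\<Sum>k\<le>n. of_nat (n choose k) * (x ^ k * y ^ (n - k)))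
      + y * (\<Sum>k\<le>n. of_nat (n choose k) * (x ^ k * y ^ (n - k)))"
    by (simp add: Suc distrib_right)
  also have "\<dots> = (\<Sum>k\<le>n. of_nat (n choose k) * (x ^ Suc k * y ^ (n - k)))
      + (\<Sum>k\<le>n. of_nat (n choose k) * (x ^ k * y ^ (Suc n - k)))"
    unfolding sum_distrib_left by (simp add: x y Suc_diff_le mult.assoc)
  also have "(\<Sum>k\<le>n. of_nat (n choose k) * (x ^ k * y ^ (Suc n - k)))
      = (\<Sum>k\<le>Suc n. of_nat (n choose k) * (x ^ k * y ^ (Suc n - k)))"
    by (simp add: binomial_eq_0)
  also have "\<dots> = y ^ Suc n + (\<Sum>k\<le>n. of_nat (n choose Suc k) * (x ^ Suc k * y ^ (n - k)))"
    by (subst sum.atMost_Suc_shift) simp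
  also have "(\<Sum>k\<le>n. of_nat (n choose k) * (x ^ Suc k * y ^ (n - k)))
      + (y ^ Suc n + (\<Sum>k\<le>n. of_nat (n choose Suc k) * (x ^ Suc k * y ^ (n - k))))
      = y ^ Suc n + (\<Sum>k\<le>n. of_nat (Suc n choose Suc k) * (x ^ Suc k * y ^ (n - k)))"
    by (simp add: sum.distrib distrib_right algebra_simps del: power_Suc)
  also have "\<dots> = (\<Sum>k\<le>Suc n. of_nat (Suc n choose k) * (x ^ k * y ^ (Suc n - k)))"
    by (subst sum.atMost_Suc_shift) simp
  finally show ?case .
qed simp

lemma frobenius_commuting:
  fixes x y :: "'a::semiring_1"
  assumes "x * y = y * x" and p: "Factorial_Ring.prime p" and char: "of_nat p = (0::'a)"
  shows "(x + y) ^ (p ^ n) = x ^ (p ^ n) + y ^ (p ^ n)"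
proof (induction n)
  case (Suc n)
  have freshman: "(u + v) ^ p = u ^ p + v ^ p" if "u * v = v * u" for u v :: 'a
  proof -
    have "(u + v) ^ p = (\<Sum>k\<le>p. of_nat (p choose k) * (u ^ k * v ^ (p - k)))"
      by (rule binomial_commuting[OF that])
    also have "\<dots> = (\<Sum>k\<in>{0, p}. of_nat (p choose k) * (u ^ k * v ^ (p - k)))"
    proof (rule sum.mono_neutral_right)
      show "\<forall>k\<in>{..p} - {0, p}. of_nat (p choose k) * (u ^ k * v ^ (p - k)) = 0"
      proof
        fix k assume "k \<in> {..p} - {0, p}"
        then have "p dvd (p choose k)"
          using p by (intro dvd_choose_prime) auto
        then have "of_nat (p choose k) = (0::'a)"
          using char by (auto elim!: dvdE)
        then show "of_nat (p choose k) * (u ^ k * v ^ (p - k)) = 0"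
          by simp
      qed
    qed auto
    also have "\<dots> = u ^ p + v ^ p"
      using p by (auto simp: prime_gt_0_nat add.commute)
    finally show ?thesis .
  qed
  have "(x + y) ^ (p ^ Suc n) = ((x + y) ^ (p ^ n)) ^ p"
    by (simp add: mult.commute flip: power_mult)
  also have "\<dots> = (x ^ (p ^ n)) ^ p + (y ^ (p ^ n)) ^ p"
    unfolding Suc by (intro freshman) (metis assms(1) power_commuting_commutes)
  finally show ?case
    by (simp add: mult.commute flip: power_mult)
qed simp

section \<open>Iterated commutators in a ring\<close>

text \<open>
  Think of \<open>b'\<close>, \<open>z'\<close> as the inverses of \<open>b\<close>, \<open>z\<close>. Moving \<open>b\<close> past \<open>Y\<close> costs a factor \<open>z\<close>, and moving
  \<open>b'\<close> past it costs \<open>z'\<close>, so \<open>[Y, b - b'] = (1 - z) Y b - (1 - z') Y b'\<close>; finally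
  \<open>1 - z' = - (1 - z) z'\<close>. Multiplying \<open>Y\<close> by something that commutes with \<open>b\<close> and \<open>b'\<close> preserves
  these relations, so the computation can be repeated.
\<close>

lemma commutator_with_inverse_difference:
  fixes b b' Y z z' :: "'a::ring_1"
  assumes Y: "b * Y = z * Y * b" and Y': "b' * Y = z' * Y * b'"
    and inv: "z' * z = 1" and z: "\<And>u. z * u = u * z" and z': "\<And>u. z' * u = u * z'"
    and bb: "b * b' = b' * b"
  defines "D \<equiv> \<lambda>n. (1 - z) ^ n * Y * (b + z' * b') ^ n"
  shows "D n * (b - b') - (b - b') * D n = D (Suc n)"
proof -
  define w where "w = 1 - z"
  define q where "q = (b + z' * b') ^ n"
  have w: "w * u = u * w" for u
    unfolding w_def left_diff_distrib right_diff_distrib z[of u] by simp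
  have wn: "w ^ n * u = u * w ^ n" for u
    by (rule power_commuting_commutes) (rule w)
  have bq: "b * q = q * b" unfolding q_def
    by (rule power_commuting_commutes[symmetric])
      (simp add: algebra_simps, metis bb mult.assoc z')
  have bq': "b' * q = q * b'" unfolding q_def
    by (rule power_commuting_commutes[symmetric])
      (simp add: algebra_simps, metis bb mult.assoc z')
  have 1: "b * (Y * q) = z * (Y * q * b)"
    by (metis Y bq mult.assoc)
  have 2: "b' * (Y * q) = z' * (Y * q * b')"
    by (metis Y' bq' mult.assoc)
  have 3: "w * (z' * u) = z' * u - u" for u
    using inv z z' unfolding w_def by (metis left_diff_distrib mult.assoc mult_1_left)
  have "Y * q * (b - b') - (b - b') * (Y * q)
      = Y * q * b - z * (Y * q * b) + (z' * (Y * q * b') - Y * q * b')"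
    using 1 2 by (simp add: algebra_simps)
  also have "\<dots> = w * (Y * q * b) + w * (z' * (Y * q * b'))"
    by (simp only: 3) (simp add: w_def algebra_simps)
  also have "\<dots> = w * (Y * (q * (b + z' * b')))"
    using z'[of "Y * q"] by (simp add: distrib_left mult.assoc) (metis mult.assoc)
  finally have step: "Y * q * (b - b') - (b - b') * (Y * q) = w * (Y * (q * (b + z' * b')))" .
  have Dn: "D n = w ^ n * (Y * q)"
    by (simp add: D_def w_def q_def mult.assoc)
  have "(b - b') * D n = w ^ n * ((b - b') * (Y * q))"
    unfolding Dn by (metis wn mult.assoc)
  then have "D n * (b - b') - (b - b') * D n = w ^ n * (Y * q * (b - b') - (b - b') * (Y * q))"
    by (simp only: Dn right_diff_distrib[of "w ^ n"] mult.assoc)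
  also have "\<dots> = D (Suc n)"
    unfolding step unfolding D_def w_def[symmetric] q_def power_Suc2 by (simp only: mult.assoc)
  finally show ?thesis .
qed

text \<open>
  The roles of \<open>z\<close> and \<open>z'\<close> are exchanged for \<open>a'\<close>, which stands for the inverse of \<open>a\<close>.
\<close>

lemma left_normed_skew_closed_form:
  fixes a a' b b' z z' :: "'a::ring_1"
  assumes inv: "z' * z = 1" and z: "\<And>u. z * u = u * z" and z': "\<And>u. z' * u = u * z'"
    and bb: "b * b' = b' * b"
    and "b * a = z * a * b" "b' * a = z' * a * b'"
    and "b * a' = z' * a' * b" "b' * a' = z * a' * b'"
  shows "left_normed (\<lambda>i. if i = 0 then a - a' else b - b') n
    = (1 - z) ^ n * a * (b + z' * b') ^ n - (1 - z') ^ n * a' * (b + z * b') ^ n"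
proof (induction n)
  case (Suc n)
  have "z * z' = 1" using inv z by metis
  note step = commutator_with_inverse_difference[of b a z b' z' n, OF assms(5,6) inv z z' bb]
    commutator_with_inverse_difference[of b a' z' b' z n, OF assms(7,8) this z' z bb]
  show ?case
    by (simp only: left_normed.simps Suc step[symmetric] if_False nat.distinct)
      (simp add: algebra_simps)
qed simp

text \<open>
  Since \<open>(1 - z) ^ n\<close> is annihilated by \<open>1 - z\<close>, it absorbs \<open>z\<close> and \<open>z'\<close>. For even \<open>n\<close> it also equals
  \<open>(1 - z') ^ n\<close>, and the two summands of the closed form combine.
\<close>

lemma left_normed_skew_char_p:
  fixes a a' b b' z z' :: "'a::ring_1"
  assumes inv: "z' * z = 1" and z: "\<And>u. z * u = u * z" and z': "\<And>u. z' * u = u * z'"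
    and bb: "b * b' = b' * b"
    and comm: "b * a = z * a * b" "b' * a = z' * a * b'"
    "b * a' = z' * a' * b" "b' * a' = z * a' * b'"
    and n: "even n" "(1 - z) ^ Suc n = 0"
  shows "left_normed (\<lambda>i. if i = 0 then a - a' else b - b') n
    = (1 - z) ^ n * (a - a') * (b + b') ^ n"
proof -
  define c where "c = (1 - z) ^ n"
  have c: "c * u = u * c" for u
    unfolding c_def by (rule power_commuting_commutes) (simp add: z algebra_simps)
  have cz: "c * z = c"
    using n(2) by (simp add: c_def power_Suc2 algebra_simps del: power_Suc)
  have cz': "c * z' = c"
    by (metis cz inv z mult.assoc mult.right_neutral)
  \<comment> \<open>Used with \<open>y = z\<close> and \<open>y = z'\<close>.\<close>
  have absorb: "c * (u + y * v) ^ k = c * (u + v) ^ k" if "c * y = c" for u v y k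
  proof (induction k)
    case (Suc k)
    have "c * (u + y * v) ^ Suc k = c * (u + v) ^ k * (u + y * v)"
      using Suc by (simp add: power_Suc2 mult.assoc[symmetric] del: power_Suc)
    also have "\<dots> = (u + v) ^ k * (c * u + c * y * v)"
      by (metis c distrib_left mult.assoc)
    also have "\<dots> = c * (u + v) ^ Suc k"
      using that by (metis c distrib_left mult.assoc power_Suc2)
    finally show ?case .
  qed simp
  have "(1 - z') ^ n = (z' * (z - 1)) ^ n"
    using inv by (simp add: algebra_simps)
  also have "\<dots> = z' ^ n * (z - 1) ^ n"
    using power_commuting_commutes[OF z'[of "z - 1"]]
    by (induction n) (simp_all add: mult.assoc power_commutes, metis mult.assoc)
  also have "(z - 1) ^ n = c"
    using n(1) by (metis c_def minus_diff_eq power_minus_even)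
  also have "z' ^ n * c = c"
    by (induction n) (simp_all add: mult.assoc, metis c cz')
  finally have "(1 - z') ^ n = c" .
  moreover have "c * a * (b + z' * b') ^ n = c * a * (b + b') ^ n"
    using absorb[OF cz', of b b' n] by (metis c mult.assoc)
  moreover have "c * a' * (b + z * b') ^ n = c * a' * (b + b') ^ n"
    using absorb[OF cz, of b b' n] by (metis c mult.assoc)
  ultimately show ?thesis
    using left_normed_skew_closed_form[OF inv z z' bb comm, of n]
    by (simp add: algebra_simps flip: c_def)
qed

lemma left_normed_in_power_ideal:
  fixes x :: "nat \<Rightarrow> 'a::ring_1"
  assumes w: "\<And>u. w * u = u * w" and comm: "\<And>u v. \<exists>t. u * v - v * u = w * t"
  shows "\<exists>u. left_normed x n = w ^ n * u"
proof (induction n)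
  case (Suc n)
  then obtain u where u: "left_normed x n = w ^ n * u"
    by blast
  obtain v where v: "u * x (Suc n) - x (Suc n) * u = w * v"
    using comm by blast
  have "w ^ n * y = y * w ^ n" for y
    using w by (rule power_commuting_commutes)
  then have "left_normed x (Suc n) = w ^ n * (u * x (Suc n) - x (Suc n) * u)"
    by (simp add: u right_diff_distrib mult.assoc)
  also have "\<dots> = w ^ Suc n * v"
    by (simp only: v power_Suc2 mult.assoc)
  finally show ?case by blast
qed simp

section \<open>The group algebra\<close>

abbreviation group_elem :: "'g \<Rightarrow> ('g::group_add \<Rightarrow>\<^sub>0 'f::field)" where
  "group_elem g \<equiv> Poly_Mapping.single g 1"

lemma group_algebra_induct [case_names zero add]:
  fixes x :: "'g::group_add \<Rightarrow>\<^sub>0 'f::field"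
  assumes "P 0" and add: "\<And>g c x. P x \<Longrightarrow> P (Poly_Mapping.single g c + x)"
  shows "P x"
proof (induction x rule: Poly_Mapping.update_induct)
  case (update f a b)
  then have "Poly_Mapping.update a b f = Poly_Mapping.single a b + f"
    by (intro poly_mapping_eqI) (auto simp: lookup_update lookup_add lookup_single when_def in_keys_iff)
  with add update show ?case by simp
qed (fact assms(1))

lemma central_group_elem:
  fixes x :: "'g::group_add \<Rightarrow>\<^sub>0 'f::field"
  assumes "\<And>g. z + g = g + z"
  shows "group_elem z * x = x * group_elem z"
  by (induction x rule: group_algebra_induct)
    (simp_all add: mult_single assms distrib_left distrib_right)

lemma single_power:
  fixes c :: "'f::field"
  shows "Poly_Mapping.single g c ^ k = Poly_Mapping.single (g [^]\<^bsub>type_group\<^esub> k) (c ^ k)"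
proof (induction k)
  case (Suc k)
  then show ?case
    unfolding power_Suc2 by (simp add: mult_single monoid.nat_pow_Suc[OF group.is_monoid[OF group_type_group]] mult.commute)
qed (simp add: monoid.nat_pow_0[OF group.is_monoid[OF group_type_group]])

text \<open>
  By bilinearity it is enough to treat group elements, and for these \<open>g h - h g = (z ^ k - 1) h g\<close>
  is a multiple of \<open>1 - z\<close>.
\<close>

lemma commutator_in_augmentation_ideal:
  fixes u v :: "'g::group_add \<Rightarrow>\<^sub>0 'f::field"
  assumes comm: "\<And>g h. \<exists>k::nat. g + h = z [^]\<^bsub>type_group\<^esub> k + (h + g)"
  shows "\<exists>t. u * v - v * u = (1 - group_elem z) * t"
proof -
  define w where "w = (1 - group_elem z :: 'g \<Rightarrow>\<^sub>0 'f)"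
  have power: "\<exists>t. group_elem z ^ k - 1 = w * t" for k
  proof (induction k)
    case 0
    have "group_elem z ^ 0 - 1 = w * 0" by simp
    then show ?case by blast
  next
    case (Suc k)
    then obtain t where t: "group_elem z ^ k - 1 = w * t" by blast
    have "group_elem z ^ Suc k - 1 = (group_elem z ^ k - 1) * group_elem z - w"
      by (simp add: w_def power_Suc2 left_diff_distrib del: power_Suc)
    also have "\<dots> = w * (t * group_elem z - 1)"
      by (simp only: t right_diff_distrib mult.assoc mult_1_right)
    finally show ?case by blast
  qed
  have ideal_add: "\<exists>t. x + y = w * t" if "\<exists>t. x = w * t" "\<exists>t. y = w * t" for x y
    using that by (metis distrib_left)
  have generators: "\<exists>t. Poly_Mapping.single g c * Poly_Mapping.single h d
      - Poly_Mapping.single h d * Poly_Mapping.single g c = w * t" for g h :: 'g and c d :: 'f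
  proof -
    obtain k :: nat where k: "g + h = z [^]\<^bsub>type_group\<^esub> k + (h + g)"
      using comm by blast
    obtain t where t: "group_elem z ^ k - 1 = w * t"
      using power by blast
    have "Poly_Mapping.single g c * Poly_Mapping.single h d - Poly_Mapping.single h d * Poly_Mapping.single g c
       = (group_elem z ^ k - 1) * Poly_Mapping.single (h + g) (c * d)"
      by (simp add: mult_single single_power k left_diff_distrib mult.commute)
    then show ?thesis
      unfolding t by (metis mult.assoc)
  qed
  have "\<exists>t. u * v - v * u = w * t"
  proof (induction u rule: group_algebra_induct)
    case zero
    show ?case by (rule exI[of _ 0]) simp
  next
    case (add g c u)
    have "\<exists>t. Poly_Mapping.single g c * v - v * Poly_Mapping.single g c = w * t"
    proof (induction v rule: group_algebra_induct)
      case zero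
      show ?case by (rule exI[of _ 0]) simp
    next
      case (add h d v)
      from ideal_add[OF generators[of g c h d] add]
      show ?case by (simp add: algebra_simps)
    qed
    from ideal_add[OF this add]
    show ?case by (simp add: algebra_simps)
  qed
  then show ?thesis unfolding w_def .
qed

text \<open>
  The binomial expansion of \<open>(1 - z) ^ n a\<close> is supported on the elements \<open>z ^ k a\<close>, which for \<open>k \<le> n\<close>
  equal \<open>a\<close> only when \<open>k = 0\<close>; that of \<open>(1 - z) ^ n a\<inverse>\<close> does not meet \<open>a\<close> at all.
\<close>

lemma lookup_power_mult_diff_inverse:
  fixes a z :: "'g::group_add"
  assumes "\<And>k. k \<le> n \<Longrightarrow> z [^]\<^bsub>type_group\<^esub> k = 0 \<Longrightarrow> k = 0"
    and "\<And>k::nat. z [^]\<^bsub>type_group\<^esub> k + - a \<noteq> a"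
  shows "Poly_Mapping.lookup ((1 - group_elem z) ^ n * (group_elem a - group_elem (- a))) a = (1::'f::field)"
proof -
  interpret group "type_group :: 'g monoid" by (rule group_type_group)
  have neg: "- group_elem z = (Poly_Mapping.single z (-1) :: 'g \<Rightarrow>\<^sub>0 'f)"
    by (simp add: single_uminus)
  have "(1 - group_elem z) ^ n = (- group_elem z + 1 :: 'g \<Rightarrow>\<^sub>0 'f) ^ n"
    by simp
  also have "\<dots> = (\<Sum>k\<le>n. of_nat (n choose k) * ((- group_elem z) ^ k * 1 ^ (n - k)))"
    by (rule binomial_commuting) simp
  also have "\<dots> = (\<Sum>k\<le>n. Poly_Mapping.single (z [^]\<^bsub>type_group\<^esub> k) (of_nat (n choose k) * (-1) ^ k))"
    unfolding neg by (simp add: single_power mult_single flip: single_of_nat)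
  finally have expand: "(1 - group_elem z) ^ n * group_elem g
      = (\<Sum>k\<le>n. Poly_Mapping.single (z [^]\<^bsub>type_group\<^esub> k + g) (of_nat (n choose k) * (-1 :: 'f) ^ k))" for g
    by (simp add: sum_distrib_right mult_single)
  have "Poly_Mapping.lookup ((1 - group_elem z) ^ n * group_elem a) a
      = (\<Sum>k\<le>n. if k = 0 then of_nat (n choose k) * (-1 :: 'f) ^ k else 0)"
    unfolding expand lookup_sum
  proof (intro sum.cong refl)
    fix k assume "k \<in> {..n}"
    then have "z [^]\<^bsub>type_group\<^esub> k + a = a \<longleftrightarrow> k = 0"
      using assms(1)[of k] add_right_cancel[of "z [^]\<^bsub>type_group\<^esub> k" a 0]
      by (auto simp: nat_pow_0[simplified])
    then show "Poly_Mapping.lookup (Poly_Mapping.single (z [^]\<^bsub>type_group\<^esub> k + a)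
        (of_nat (n choose k) * (-1 :: 'f) ^ k)) a = (if k = 0 then of_nat (n choose k) * (-1) ^ k else 0)"
      by (simp add: lookup_single when_def)
  qed
  moreover have "Poly_Mapping.lookup ((1 - group_elem z) ^ n * group_elem (- a)) a = (0::'f)"
    unfolding expand lookup_sum
    by (intro sum.neutral) (use assms(2) in \<open>auto simp: lookup_single when_def\<close>)
  ultimately show ?thesis
    by (simp add: right_diff_distrib lookup_minus sum.delta)
qed

lemma group_elem_diff_inverse_skew: "group_elem a - group_elem (- a) \<in> skew_elements"
  unfolding skew_elements_def
  by (auto intro!: poly_mapping_eqI simp: lookup_ga_star lookup_minus lookup_single when_def)

lemma two_neq_zero_of_char:
  assumes "CHAR('f::field) = p" "p > 2"
  shows "(2::'f) \<noteq> 0"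
  using assms of_nat_eq_0_iff_char_dvd[where ?'a = 'f, of 2] by (auto dest: dvd_imp_le)

text \<open>
  By the Frobenius map, the powers of \<open>b + b\<inverse>\<close> with exponent \<open>p ^ k\<close> are equal to \<open>2\<close> for large
  \<open>k\<close>, so \<open>b + b\<inverse>\<close> is a unit.
\<close>

lemma mult_inverse_sum_cancel:
  fixes b :: "'g::group_add" and x :: "'g \<Rightarrow>\<^sub>0 'f::field"
  assumes p: "Factorial_Ring.prime p" "p > 2" and char: "CHAR('f) = p"
    and ord: "b [^]\<^bsub>type_group\<^esub> (p ^ m) = 0"
    and zero: "x * (group_elem b + group_elem (- b)) ^ n = 0"
  shows "x = 0"
proof -
  interpret group "type_group :: 'g monoid" by (rule group_type_group)
  define s where "s = (group_elem b + group_elem (- b) :: 'g \<Rightarrow>\<^sub>0 'f)"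
  \<comment> \<open>The exponent must kill \<open>b\<close> and also be at least \<open>n\<close>; the summand \<open>n\<close> ensures the latter.\<close>
  define N where "N = p ^ (m + n)"
  have "b [^]\<^bsub>type_group\<^esub> N = 0"
    using ord nat_pow_pow[of b "p ^ m" "p ^ n"] nat_pow_one by (simp add: N_def power_add)
  moreover from this have "(- b) [^]\<^bsub>type_group\<^esub> N = 0"
    using nat_pow_inv[of b N] by simp
  moreover have "of_nat p = (0 :: 'g \<Rightarrow>\<^sub>0 'f)"
    using char by (metis of_nat_CHAR single_of_nat single_zero)
  ultimately have "s ^ N = 2"
    unfolding s_def N_def using p by (subst frobenius_commuting) (simp_all add: mult_single single_power)
  moreover have "n \<le> N"
  proof -
    have "n < 2 ^ n" by (rule less_exp)
    also have "\<dots> \<le> 2 ^ (m + n)" by simp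
    also have "\<dots> \<le> N" using p(2) by (simp add: N_def power_mono)
    finally show ?thesis by simp
  qed
  ultimately have "x * 2 = 0"
    using zero by (metis le_add_diff_inverse mult.assoc mult_zero_left power_add s_def)
  then have "2 * Poly_Mapping.lookup x g = 0" for g
    by (metis lookup_add lookup_zero mult_2 mult_2_right)
  then show ?thesis
    using two_neq_zero_of_char[OF char p(2)] by (intro poly_mapping_eqI) simp
qed

section \<open>The Lie nilpotency index\<close>

lemma lower_central_eq_zero_iff:
  "lower_central L n = {0} \<longleftrightarrow> (\<forall>x. (\<forall>i\<le>n. x i \<in> L) \<longrightarrow> left_normed x n = 0)"
proof -
  interpret vector_space "ga_scale :: 'f::field \<Rightarrow> ('g::group_add \<Rightarrow>\<^sub>0 'f) \<Rightarrow> _"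
    by (rule vector_space_ga_scale)
  have "span S = {0} \<longleftrightarrow> S \<subseteq> {0}" for S
    using span_superset[of S] span_mono[of S "{0}"] span_zero[of S] by (auto simp: span_insert_0)
  then show ?thesis
    unfolding lower_central_def by auto
qed

lemma lower_central_eq_zero_mono:
  assumes "lower_central L n = {0}" "n \<le> m"
  shows "lower_central L m = {0}"
  unfolding lower_central_eq_zero_iff
proof (intro allI impI)
  fix x assume x: "\<forall>i\<le>m. x i \<in> L"
  show "left_normed x m = 0"
    using assms(2) x
  proof (induction m rule: dec_induct)
    case base
    with assms(1) show ?case by (simp add: lower_central_eq_zero_iff)
  qed simp
qed

lemma lie_nilpotency_index_eqI:
  assumes "has_lie_nilpotency_index L n"
  shows "lie_nilpotency_index L = n"
  unfolding lie_nilpotency_index_def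
proof (rule the_equality[where P = "has_lie_nilpotency_index L", OF assms])
  have "n \<le> m" if "has_lie_nilpotency_index L n" "has_lie_nilpotency_index L m" for n m
    using that lower_central_eq_zero_mono[of L m "n - 1"]
    unfolding has_lie_nilpotency_index_def by linarith
  then show "m = n" if "has_lie_nilpotency_index L m" for m
    using assms that by (meson le_antisym)
qed

theorem corollary2:
  fixes p :: nat
  assumes "Factorial_Ring.prime p" and "p > 2"
    and "p_group p (type_group :: 'g::group_add monoid)"
    and "card (derived (type_group :: 'g monoid) (carrier type_group)) = p"
    and "CHAR('f::field) = p"
  shows "lie_nilpotent (UNIV :: ('g \<Rightarrow>\<^sub>0 'f) set)
    \<and> lie_nilpotent (skew_elements :: ('g \<Rightarrow>\<^sub>0 'f) set)
    \<and> lie_nilpotency_index (UNIV :: ('g \<Rightarrow>\<^sub>0 'f) set)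
        = lie_nilpotency_index (skew_elements :: ('g \<Rightarrow>\<^sub>0 'f) set)"
proof -
  interpret group "type_group :: 'g monoid" by (rule group_type_group)
  note p = assms(1,2) and char = assms(5)
  have "odd p"
    using p by (simp add: prime_odd_nat)
  obtain a b z :: 'g where ba: "b + a = z + a + b" and ord_z: "ord z = p"
    and central: "\<And>g. z + g = g + z"
    and comm: "\<And>g h. \<exists>k::nat. g + h = z [^]\<^bsub>type_group\<^esub> k + (h + g)"
    and a: "\<And>k::nat. z [^]\<^bsub>type_group\<^esub> k + - a \<noteq> a"
    using derived_order_p_noncommuting_pair[OF assms(1-4)] by blast
  note inverses = commutation_of_inverses[OF central ba]

  have char': "of_nat p = (0 :: 'g \<Rightarrow>\<^sub>0 'f)"
    using char by (metis of_nat_CHAR single_of_nat single_zero)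
  define w where "w = (1 - group_elem z :: 'g \<Rightarrow>\<^sub>0 'f)"
  have w_central: "w * x = x * w" for x
    using central_group_elem[OF central, of x] by (simp add: w_def left_diff_distrib right_diff_distrib)
  \<comment> \<open>The exponent is written as \<open>p ^ 1\<close> to match the iterated Frobenius map.\<close>
  have "w ^ (p ^ 1) = 1 + (- group_elem z) ^ (p ^ 1)"
    unfolding w_def using frobenius_commuting[OF _ p(1) char', of 1 "- group_elem z" 1] by simp
  also have "\<dots> = 1 - group_elem z ^ p"
    using \<open>odd p\<close> by simp
  also have "group_elem z ^ p = (1 :: 'g \<Rightarrow>\<^sub>0 'f)"
    using pow_ord_eq_1[of z] by (simp add: single_power ord_z)
  finally have w_nilpotent: "w ^ p = 0" by simp

  \<comment> \<open>This holds in the whole group algebra, so the bound applies to every subset of it.\<close>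
  have w_commutator: "\<exists>t. u * v - v * u = w * t" for u v
    unfolding w_def by (rule commutator_in_augmentation_ideal[OF comm])
  have upper: "lower_central L p = {0}" for L :: "('g \<Rightarrow>\<^sub>0 'f) set"
    unfolding lower_central_eq_zero_iff
  proof (intro allI impI)
    fix x :: "nat \<Rightarrow> 'g \<Rightarrow>\<^sub>0 'f"
    obtain u where "left_normed x p = w ^ p * u"
      using left_normed_in_power_ideal[OF w_central w_commutator] by blast
    then show "left_normed x p = 0"
      by (simp add: w_nilpotent)
  qed

  define x :: "nat \<Rightarrow> 'g \<Rightarrow>\<^sub>0 'f" where
    "x = (\<lambda>i. if i = 0 then group_elem a - group_elem (- a) else group_elem b - group_elem (- b))"
  have "left_normed x (p - 1)
      = w ^ (p - 1) * (group_elem a - group_elem (- a)) * (group_elem b + group_elem (- b)) ^ (p - 1)"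
    unfolding x_def w_def
  proof (rule left_normed_skew_char_p[where z' = "group_elem (- z)"])
    show "group_elem z * u = u * group_elem z" for u :: "'g \<Rightarrow>\<^sub>0 'f"
      by (rule central_group_elem[OF central])
    show "group_elem (- z) * u = u * group_elem (- z)" for u :: "'g \<Rightarrow>\<^sub>0 'f"
      by (rule central_group_elem[OF inverses(1)])
    show "(1 - group_elem z :: 'g \<Rightarrow>\<^sub>0 'f) ^ Suc (p - 1) = 0"
      using w_nilpotent p(2) by (simp add: w_def)
  qed (use ba inverses(2-4) \<open>odd p\<close> p(2) in
      \<open>simp_all add: mult_single del: add_uminus_conv_diff\<close>)
  moreover have "w ^ (p - 1) * (group_elem a - group_elem (- a)) \<noteq> 0"
  proof -
    have "k = 0" if "k \<le> p - 1" "z [^]\<^bsub>type_group\<^esub> k = 0" for k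
      using that pow_eq_id[of z k] ord_z p by (auto dest: dvd_imp_le)
    then have "Poly_Mapping.lookup (w ^ (p - 1) * (group_elem a - group_elem (- a))) a = 1"
      unfolding w_def by (intro lookup_power_mult_diff_inverse a)
    then show ?thesis by force
  qed
  moreover obtain m where "b [^]\<^bsub>type_group\<^esub> (p ^ m) = 0"
    using assms(3) pow_ord_eq_1[of b] unfolding p_group_def by (metis UNIV_I type_group_simps(1,3))
  ultimately have "left_normed x (p - 1) \<noteq> 0"
    using mult_inverse_sum_cancel[OF p char] by metis
  moreover have "x i \<in> skew_elements" for i
    by (simp add: x_def group_elem_diff_inverse_skew)
  ultimately have lower: "lower_central L (p - 1) \<noteq> {0}"
    if "skew_elements \<subseteq> L" for L :: "('g \<Rightarrow>\<^sub>0 'f) set"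
    using that unfolding lower_central_eq_zero_iff by blast

  have "has_lie_nilpotency_index L p" if "skew_elements \<subseteq> L" for L :: "('g \<Rightarrow>\<^sub>0 'f) set"
    using upper lower[OF that] p by (simp add: has_lie_nilpotency_index_def)
  then show ?thesis
    using lie_nilpotency_index_eqI unfolding lie_nilpotent_def by (metis subset_UNIV order_refl)
qed

end
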